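(* Let $r$ be a nonnegative integer and $m$ an odd positive integer. Assume that all denominators occurring below are nonzero, that both series below converge, and that $$\lim_{n\to\infty}\frac{(n+1)H_n-n}{\prod_{j=0}^{2m-1}w_{n+1+r+j}}=0 .$$ Then $$\sum_{k = 1}^\infty \frac{H_k}{\prod_{j = 0}^{2m - 1} w_{k + r + j}} = v_m \sum_{k = 1}^\infty \frac{(k + 1 )H_k - k}{\prod_{j = 0}^{m - 1} w_{k + r + j}\, \prod_{j = m + 1}^{2m} w_{k + r + j}} .$$
   Context: Let $a,b,p$ be complex numbers. The sequence $(w_n)_{n\ge0}$ is defined by $w_0=a$, $w_1=b$, $w_n=p\,w_{n-1}+w_{n-2}$ for $n\ge 2$. The companion sequence is $v_0=2$, $v_1=p$, $v_n=p\,v_{n-1}+v_{n-2}$ for $n\ge2$. $H_n=\sum_{i=1}^n \frac1i$ is the $n$th harmonic number. *)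

theory Defs
  imports "HOL-Analysis.Harmonic_Numbers"
begin

fun w_seq :: "complex \<Rightarrow> complex \<Rightarrow> complex \<Rightarrow> nat \<Rightarrow> complex" where
  "w_seq a b p 0 = a"
| "w_seq a b p (Suc 0) = b"
| "w_seq a b p (Suc (Suc n)) = p * w_seq a b p (Suc n) + w_seq a b p n"

fun v_seq :: "complex \<Rightarrow> nat \<Rightarrow> complex" where
  "v_seq p 0 = 2"
| "v_seq p (Suc 0) = p"
| "v_seq p (Suc (Suc n)) = p * v_seq p (Suc n) + v_seq p n"

end

theory Submission
  imports Defs
begin

text \<open>
  Write \<open>P k\<close> for the product of the \<open>2 * m\<close> consecutive terms starting at
  \<open>w (k + r)\<close>. The numerators on the right are the partial sums of those on the
  left, \<open>H 1 + ... + H n = (n + 1) * H n - n\<close>, so the identity is a summation by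
  parts (\<open>sum_divide_by_parts\<close>) in which the hypothesis on the limit removes the
  boundary term.

  The difference \<open>1 / P k - 1 / P (k + 1)\<close> that it leaves has numerator
  \<open>w (k + r + 2 * m) - w (k + r)\<close> over a product of \<open>2 * m + 1\<close> terms. For odd \<open>m\<close>
  this numerator is \<open>v m * w (k + r + m)\<close> (\<open>v_seq_mult_w_seq\<close>), a multiple of the
  middle term of the denominator; cancelling it leaves the product with the gap at
  \<open>j = m\<close> (\<open>inverse_prod_window_diff\<close>).
\<close>

text \<open>
  This is \<open>L m * F (i + m) = F (i + 2 * m) + (-1) ^ m * F i\<close> for Fibonacci and Lucas
  numbers. In terms of the roots \<open>\<alpha>\<close>, \<open>\<beta>\<close> of \<open>x\<^sup>2 = p * x + 1\<close> it says that
  multiplying by \<open>\<alpha> ^ m + \<beta> ^ m\<close> shifts by \<open>m\<close> in both directions, as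
  \<open>\<alpha> * \<beta> = -1\<close>; the induction below also covers the double root.
\<close>

lemma v_seq_mult_w_seq:
  "v_seq p m * w_seq a b p (i + m) = w_seq a b p (i + 2 * m) + (-1) ^ m * w_seq a b p i"
proof (induction m arbitrary: i rule: induct_nat_012)
  case 0
  show ?case by simp
next
  case 1
  show ?case by simp
next
  case (ge2 m)
  let ?w = "w_seq a b p"
  have "v_seq p (Suc (Suc m)) * ?w (i + Suc (Suc m)) =
      p * (v_seq p (Suc m) * ?w (Suc i + Suc m)) + v_seq p m * ?w (Suc (Suc i) + m)"
    by (simp add: algebra_simps)
  also have "\<dots> = p * (?w (Suc i + 2 * Suc m) + (-1) ^ Suc m * ?w (Suc i))
      + (?w (Suc (Suc i) + 2 * m) + (-1) ^ m * ?w (Suc (Suc i)))"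
    by (simp only: ge2)
  also have "\<dots> = ?w (i + 2 * Suc (Suc m)) + (-1) ^ Suc (Suc m) * ?w i"
    by (simp add: algebra_simps)
  finally show ?case .
qed

lemma sum_harm_Suc:
  "(of_nat (Suc n) + 1) * harm (Suc n) - of_nat (Suc n) =
     ((of_nat n + 1) * harm n - of_nat n) + (harm (Suc n) :: 'a :: real_normed_field)"
proof -
  have "(of_nat n + 1 :: 'a) \<noteq> 0"
    using of_nat_neq_0[of n, where 'a = 'a] by (simp add: add.commute)
  then show ?thesis
    by (simp add: harm_Suc field_simps)
qed

text \<open>
  Both window products and the product with a gap come from the full product over
  \<open>j = 0, ..., 2 * m\<close> by deleting one factor: the last, the first, or the middle one.
\<close>

lemma inverse_prod_window_diff:
  fixes f :: "nat \<Rightarrow> 'a :: field"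
  assumes "m > 0"
    and nz: "(\<Prod>j=0..2*m-1. f j) \<noteq> 0" "(\<Prod>j=0..2*m-1. f (Suc j)) \<noteq> 0"
    and gap: "f (2 * m) - f 0 = c * f m"
  shows "1 / (\<Prod>j=0..2*m-1. f j) - 1 / (\<Prod>j=0..2*m-1. f (Suc j)) =
    c / ((\<Prod>j=0..m-1. f j) * (\<Prod>j=m+1..2*m. f j))"
proof -
  let ?full = "\<Prod>j=0..2*m. f j"
  let ?P = "\<Prod>j=0..2*m-1. f j" and ?Q = "\<Prod>j=0..2*m-1. f (Suc j)"
  let ?D = "(\<Prod>j=0..m-1. f j) * (\<Prod>j=m+1..2*m. f j)"
  have last: "?full = ?P * f (2 * m)"
    using \<open>m > 0\<close> prod.atLeast0_atMost_Suc[of f "2 * m - 1"] by simp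
  have first: "?full = f 0 * ?Q"
    using \<open>m > 0\<close> prod.atLeast0_atMost_Suc_shift[of f "2 * m - 1"] by simp
  have "?full = f m * prod f ({0..2*m} - {m})"
    by (rule prod.remove) auto
  also have "{0..2*m} - {m} = {0..m-1} \<union> {m+1..2*m}"
    using \<open>m > 0\<close> by auto
  also have "prod f \<dots> = ?D"
    using \<open>m > 0\<close> by (intro prod.union_disjoint) auto
  finally have middle: "?full = f m * ?D" .
  have ne: "f m \<noteq> 0" "f 0 \<noteq> 0"
    using nz(1) \<open>m > 0\<close> by auto
  have "f (2 * m) = f (Suc (2 * m - 1))"
    using \<open>m > 0\<close> by simp
  then have last_ne: "f (2 * m) \<noteq> 0"
    using nz(2) by auto
  have "1 / ?P = f (2 * m) / ?full"
    using last nz(1) last_ne by simp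
  moreover have "1 / ?Q = f 0 / ?full"
    using first nz(2) ne by simp
  ultimately have "1 / ?P - 1 / ?Q = c * f m / ?full"
    by (simp add: diff_divide_distrib[symmetric] gap)
  also have "\<dots> = c / ?D"
    using middle ne by simp
  finally show ?thesis .
qed

text \<open>
  Summation by parts for \<open>\<Sum>s k / P k\<close>, with \<open>S\<close> the partial sums of \<open>s\<close>. The index
  of \<open>s\<close> is kept one ahead so that \<open>S 0 = 0\<close> is the only boundary value at the left end.
\<close>

lemma sum_divide_by_parts:
  fixes S s P R :: "nat \<Rightarrow> 'a :: field"
  assumes "S 0 = 0"
    and S: "\<And>n. S (Suc n) = S n + s (Suc n)"
    and P: "\<And>n. 1 / P (Suc n) - 1 / P (Suc (Suc n)) = R (Suc n)"
  shows "(\<Sum>k<n. s (Suc k) / P (Suc k)) = S n / P (Suc n) + (\<Sum>k<n. S (Suc k) * R (Suc k))"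
proof (induction n)
  case 0
  show ?case by (simp add: \<open>S 0 = 0\<close>)
next
  case (Suc n)
  have "S n / P (Suc n) + s (Suc n) / P (Suc n) = S (Suc n) * (1 / P (Suc n))"
    by (simp add: S add_divide_distrib)
  also have "1 / P (Suc n) = 1 / P (Suc (Suc n)) + R (Suc n)"
    by (simp add: P[symmetric])
  finally show ?case
    by (simp add: Suc.IH algebra_simps)
qed

theorem proposition5:
  fixes a b p :: complex and r m :: nat
  assumes "odd m" and "m > 0"
    and denom1: "\<And>k. k \<ge> 1 \<Longrightarrow> (\<Prod>j=0..2*m-1. w_seq a b p (k + r + j)) \<noteq> 0"
    and denom2: "\<And>k. k \<ge> 1 \<Longrightarrow>
          (\<Prod>j=0..m-1. w_seq a b p (k + r + j)) * (\<Prod>j=m+1..2*m. w_seq a b p (k + r + j)) \<noteq> 0"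
    and conv1: "summable (\<lambda>k. harm (Suc k) / (\<Prod>j=0..2*m-1. w_seq a b p (Suc k + r + j)))"
    and conv2: "summable (\<lambda>k. ((of_nat (Suc k) + 1) * harm (Suc k) - of_nat (Suc k)) /
          ((\<Prod>j=0..m-1. w_seq a b p (Suc k + r + j)) * (\<Prod>j=m+1..2*m. w_seq a b p (Suc k + r + j))))"
    and lim: "(\<lambda>n. ((of_nat n + 1) * harm n - of_nat n) /
          (\<Prod>j=0..2*m-1. w_seq a b p (n + 1 + r + j))) \<longlonglongrightarrow> 0"
  shows "(\<Sum>k. harm (Suc k) / (\<Prod>j=0..2*m-1. w_seq a b p (Suc k + r + j))) =
         v_seq p m *
         (\<Sum>k. ((of_nat (Suc k) + 1) * harm (Suc k) - of_nat (Suc k)) /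
          ((\<Prod>j=0..m-1. w_seq a b p (Suc k + r + j)) * (\<Prod>j=m+1..2*m. w_seq a b p (Suc k + r + j))))"
proof -
  define S :: "nat \<Rightarrow> complex" where "S n = (of_nat n + 1) * harm n - of_nat n" for n
  define P where "P k = (\<Prod>j=0..2*m-1. w_seq a b p (k + r + j))" for k
  define D where "D k = (\<Prod>j=0..m-1. w_seq a b p (k + r + j)) *
    (\<Prod>j=m+1..2*m. w_seq a b p (k + r + j))" for k
  have diff: "1 / P (Suc n) - 1 / P (Suc (Suc n)) = v_seq p m / D (Suc n)" for n
  proof -
    let ?f = "\<lambda>j. w_seq a b p (Suc n + r + j)"
    have P_next: "P (Suc (Suc n)) = (\<Prod>j=0..2*m-1. ?f (Suc j))"
      by (simp add: P_def)
    have "?f (2 * m) - ?f 0 = v_seq p m * ?f m"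
      using v_seq_mult_w_seq[of p m a b "Suc n + r"] \<open>odd m\<close> by simp
    then show ?thesis
      using inverse_prod_window_diff[of m ?f "v_seq p m"] \<open>m > 0\<close>
        denom1[of "Suc n"] denom1[of "Suc (Suc n)"]
      unfolding P_next[symmetric] P_def[symmetric] D_def[symmetric] by simp
  qed
  have parts: "(\<Sum>k<n. harm (Suc k) / P (Suc k)) =
      S n / P (Suc n) + v_seq p m * (\<Sum>k<n. S (Suc k) / D (Suc k))" for n
  proof -
    have "S 0 = 0"
      by (simp add: S_def harm_def)
    moreover have "S (Suc k) = S k + harm (Suc k)" for k
      unfolding S_def by (rule sum_harm_Suc)
    ultimately show ?thesis
      using sum_divide_by_parts[of S harm P "\<lambda>k. v_seq p m / D k" n] diff
      by (simp add: sum_distrib_left mult.commute)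
  qed
  have "(\<lambda>n. S n / P (Suc n)) \<longlonglongrightarrow> 0"
    using lim by (simp add: S_def P_def)
  moreover have "(\<lambda>k. S (Suc k) / D (Suc k)) sums (\<Sum>k. S (Suc k) / D (Suc k))"
    using conv2 unfolding S_def D_def by (rule summable_sums)
  ultimately have "(\<lambda>n. S n / P (Suc n) + v_seq p m * (\<Sum>k<n. S (Suc k) / D (Suc k)))
      \<longlonglongrightarrow> 0 + v_seq p m * (\<Sum>k. S (Suc k) / D (Suc k))"
    unfolding sums_def by (intro tendsto_intros)
  then have "(\<lambda>k. harm (Suc k) / P (Suc k)) sums (v_seq p m * (\<Sum>k. S (Suc k) / D (Suc k)))"
    unfolding sums_def parts by simp
  then show ?thesis
    unfolding S_def P_def D_def by (rule sums_unique[symmetric])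
qed

end
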